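(* Let $f_i:\mathbb{R}^n\to(-\infty,\infty]$, $1\le i\le r$, be proper closed functions and let $f:=\min_{1\le i\le r}f_i$ be continuous on $\mathrm{dom}\,\partial f$. Let $\bar x\in \mathrm{dom}\,\partial f\cap\big(\bigcap_{i\in I(\bar x)}\mathrm{dom}\,\partial f_i\big)$, where $I(\bar x):=\{i: f_i(\bar x)=f(\bar x)\}$. Suppose further that each $f_i$, $i\in I(\bar x)$, satisfies the KL property at $\bar x$ with an exponent of $\alpha_i\in[0,1)$. Then $f$ satisfies the KL property at $\bar x$ with an exponent of $\alpha=\max\{\alpha_i: i\in I(\bar x)\}$.
   Context: Closed means lower semicontinuous; proper means never $-\infty$ and not identically $+\infty$; $\mathrm{dom}\,f=\{x: f(x)<\infty\}$. For a proper function $f$ and $x\in\mathrm{dom}\,f$, the regular subdifferential is $\widehat\partial f(x)=\{v: \liminf_{z\to x,z\ne x}\frac{f(z)-f(x)-\langle v,z-x\rangle}{\|z-x\|}\ge 0\}$ and the (limiting) subdifferential $\partial f(x)$ is the set of $v$ for which there exist $x^t\to x$ with $f(x^t)\to f(x)$ and $v^t\to v$ with $v^t\in\widehat\partial f(x^t)$ for each $t$; $\partial f(x)=\emptyset$ if $x\notin\mathrm{dom}\,f$. $\mathrm{dom}\,\partial f=\{x:\partial f(x)\ne\emptyset\}$. "$f$ is continuous on a set $S$" means that the restriction of $f$ to $S$ is continuous. KL property with exponent: a proper closed function $f$ has the KL property at $\bar x\in\mathrm{dom}\,\partial f$ with an exponent of $\alpha\in[0,1)$ if there exist $c,\epsilon>0$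 and $\nu\in(0,\infty]$ such that $\mathrm{dist}(0,\partial f(x))\ge c\,(f(x)-f(\bar x))^\alpha$ whenever $\|x-\bar x\|\le\epsilon$ and $f(\bar x)<f(x)<f(\bar x)+\nu$ (with $\mathrm{dist}(0,\emptyset)=+\infty$). *)

theory Defs
  imports "HOL-Analysis.Analysis"
begin

definition effective_dom :: "('a \<Rightarrow> ereal) \<Rightarrow> 'a set" where
  "effective_dom f = {x. f x < \<infinity>}"

definition proper_fun :: "('a \<Rightarrow> ereal) \<Rightarrow> bool" where
  "proper_fun f \<longleftrightarrow> (\<forall>x. f x \<noteq> -\<infinity>) \<and> (\<exists>x. f x \<noteq> \<infinity>)"

definition lower_semicont :: "('a::topological_space \<Rightarrow> ereal) \<Rightarrow> bool" where
  "lower_semicont f \<longleftrightarrow> (\<forall>x. f x \<le> Liminf (at x) f)"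

(* Meant for proper f, so that f x is finite on the effective domain; the
   difference quotient is then infinite exactly where f z is. *)
definition regular_subdiff :: "('a::euclidean_space \<Rightarrow> ereal) \<Rightarrow> 'a \<Rightarrow> 'a set" where
  "regular_subdiff f x =
     {v. x \<in> effective_dom f \<and>
         0 \<le> Liminf (at x) (\<lambda>z. (f z - f x - ereal (v \<bullet> (z - x))) / ereal (norm (z - x)))}"

definition limiting_subdiff :: "('a::euclidean_space \<Rightarrow> ereal) \<Rightarrow> 'a \<Rightarrow> 'a set" where
  "limiting_subdiff f x =
     {v. x \<in> effective_dom f \<and>
         (\<exists>(xs :: nat \<Rightarrow> 'a) (vs :: nat \<Rightarrow> 'a).
            xs \<longlonglongrightarrow> x \<and> (\<lambda>t. f (xs t)) \<longlonglongrightarrow> f x \<and> vs \<longlonglongrightarrow> v \<and>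
            (\<forall>t. vs t \<in> regular_subdiff f (xs t)))}"

definition dom_subdiff :: "('a::euclidean_space \<Rightarrow> ereal) \<Rightarrow> 'a set" where
  "dom_subdiff f = {x. limiting_subdiff f x \<noteq> {}}"

(* Unlike infdist, this has the value infinity on the empty set. *)
definition ext_dist :: "'a::metric_space \<Rightarrow> 'a set \<Rightarrow> ereal" where
  "ext_dist x S = (INF y\<in>S. ereal (dist x y))"

(* The radius nu is extended-valued, as it may be infinite.  At the points
   considered f x and f xbar are finite and f x - f xbar > 0, so
   real_of_ereal loses nothing, and the power is 1 when the exponent is 0. *)
definition KL_exponent :: "('a::euclidean_space \<Rightarrow> ereal) \<Rightarrow> 'a \<Rightarrow> real \<Rightarrow> bool" where
  "KL_exponent f xbar \<alpha> \<longleftrightarrow>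
     proper_fun f \<and> lower_semicont f \<and> xbar \<in> dom_subdiff f \<and> 0 \<le> \<alpha> \<and> \<alpha> < 1 \<and>
     (\<exists>(c::real) (\<epsilon>::real) (\<nu>::ereal). c > 0 \<and> \<epsilon> > 0 \<and> \<nu> > 0 \<and>
        (\<forall>x. norm (x - xbar) \<le> \<epsilon> \<and> f xbar < f x \<and> f x < f xbar + \<nu> \<longrightarrow>
           ext_dist 0 (limiting_subdiff f x)
             \<ge> ereal (c * (real_of_ereal (f x - f xbar)) powr \<alpha>)))"

end

theory Submission
  imports Defs
begin

text \<open>
  Every limiting subgradient at a point x of the pointwise minimum of finitely many lower
  semicontinuous functions is a limiting subgradient, at x, of some function of the family that is
  active at x (that attains the minimum there).  For
  regular subgradients this is monotonicity: an active function lies above the minimum and touches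
  it, so its difference quotients are at least as large.  The passage to limits is the pigeonhole
  principle: along a sequence of points some index is active infinitely often, and lower
  semicontinuity keeps this index active at the limit.  This is lemma
  \<open>limiting_subdiff_Min_subset\<close>.

  Hence the distance from 0 to the subdifferential of the minimum at x is bounded below by the
  distance to the subdifferential of a function active at x.  If x is close to the reference point
  and the value of the minimum at x is only slightly above its reference value, lower
  semicontinuity rules out every index that is not active at the reference point.  The remaining
  functions satisfy the KL inequality with the same reference value, and with the common maximal
  exponent because raising the exponent weakens the inequality when the function gap is at most 1
  (lemma \<open>KL_exponent_mono\<close>).  Finitely many constants are then merged by taking minima.
\<close>

section \<open>Lower semicontinuity and finite minima\<close>

text \<open>Lower semicontinuity is defined through punctured neighbourhoods, but a sequence may hit its
  limit; this form covers that case.\<close>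

lemma lower_semicont_eventually_nhds:
  fixes g :: "'a::topological_space \<Rightarrow> ereal"
  assumes "lower_semicont g" "m < g x"
  shows "eventually (\<lambda>z. m < g z) (nhds x)"
proof -
  have "eventually (\<lambda>z. m < g z) (at x)"
    using assms unfolding lower_semicont_def le_Liminf_iff by blast
  then show ?thesis
    using assms(2) unfolding eventually_at_filter by (auto elim!: eventually_mono)
qed

lemma lower_semicont_le_limit:
  fixes g :: "'a::topological_space \<Rightarrow> ereal"
  assumes "lower_semicont g" "xs \<longlonglongrightarrow> x" "(\<lambda>t. g (xs t)) \<longlonglongrightarrow> l"
  shows "g x \<le> l"
proof (rule dense_le)
  fix m assume "m < g x"
  then have "eventually (\<lambda>t. m < g (xs t)) sequentially"
    using lower_semicont_eventually_nhds[OF assms(1)] assms(2) unfolding filterlim_iff by blast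
  then have "eventually (\<lambda>t. m \<le> g (xs t)) sequentially"
    by (auto elim: eventually_mono)
  then show "m \<le> l"
    using tendsto_lowerbound[OF assms(3)] by simp
qed

lemma lower_semicont_Min:
  fixes g :: "'i \<Rightarrow> 'a::topological_space \<Rightarrow> ereal"
  assumes "finite J" "J \<noteq> {}" "\<And>i. i \<in> J \<Longrightarrow> lower_semicont (g i)"
  shows "lower_semicont (\<lambda>x. Min ((\<lambda>i. g i x) ` J))"
  unfolding lower_semicont_def le_Liminf_iff
proof (intro allI impI)
  fix x m assume "m < Min ((\<lambda>i. g i x) ` J)"
  then have "\<forall>i\<in>J. m < g i x"
    using assms by simp
  then have "\<forall>i\<in>J. eventually (\<lambda>z. m < g i z) (at x)"
    using assms(3) unfolding lower_semicont_def le_Liminf_iff by blast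
  then have "eventually (\<lambda>z. \<forall>i\<in>J. m < g i z) (at x)"
    using assms(1) by (simp add: eventually_ball_finite)
  then show "eventually (\<lambda>z. m < Min ((\<lambda>i. g i z) ` J)) (at x)"
    using assms by simp
qed

lemma proper_fun_Min:
  fixes g :: "'i \<Rightarrow> 'a \<Rightarrow> ereal"
  assumes "finite J" "J \<noteq> {}" "\<And>i. i \<in> J \<Longrightarrow> proper_fun (g i)"
  shows "proper_fun (\<lambda>x. Min ((\<lambda>i. g i x) ` J))"
  unfolding proper_fun_def
proof (intro conjI allI)
  fix x
  have "Min ((\<lambda>i. g i x) ` J) \<in> (\<lambda>i. g i x) ` J"
    using assms by (intro Min_in) auto
  then show "Min ((\<lambda>i. g i x) ` J) \<noteq> -\<infinity>"
    using assms(3) unfolding proper_fun_def by force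
next
  obtain i where i: "i \<in> J" using assms(2) by blast
  then obtain x where x: "g i x \<noteq> \<infinity>"
    using assms(3) unfolding proper_fun_def by blast
  have "Min ((\<lambda>i. g i x) ` J) \<le> g i x"
    using assms(1) i by simp
  then show "\<exists>x. Min ((\<lambda>i. g i x) ` J) \<noteq> \<infinity>"
    using x by (intro exI[of _ x]) auto
qed

section \<open>Subgradients of a finite minimum\<close>

lemma regular_subdiff_mono_touching:
  fixes f g :: "'a::euclidean_space \<Rightarrow> ereal"
  assumes "\<And>z. f z \<le> g z" "f x = g x"
  shows "regular_subdiff f x \<subseteq> regular_subdiff g x"
proof
  fix v assume v: "v \<in> regular_subdiff f x"
  have "Liminf (at x) (\<lambda>z. (f z - f x - ereal (v \<bullet> (z - x))) / ereal (norm (z - x)))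
      \<le> Liminf (at x) (\<lambda>z. (g z - g x - ereal (v \<bullet> (z - x))) / ereal (norm (z - x)))"
  proof (rule Liminf_mono)
    show "eventually (\<lambda>z. (f z - f x - ereal (v \<bullet> (z - x))) / ereal (norm (z - x))
        \<le> (g z - g x - ereal (v \<bullet> (z - x))) / ereal (norm (z - x))) (at x)"
      using assms unfolding eventually_at_filter
      by (auto intro!: always_eventually ereal_divide_right_mono ereal_minus_mono)
  qed
  then show "v \<in> regular_subdiff g x"
    using v assms(2) unfolding regular_subdiff_def effective_dom_def by (auto intro: order_trans)
qed

text \<open>A subgradient sequence for the minimum has a subsequence on which one fixed index is active.
  The values of that function converge to the minimum at x, so lower semicontinuity makes it active
  at x as well, and the subsequence certifies a limiting subgradient of it.\<close>

lemma limiting_subdiff_Min_subset: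
  fixes g :: "'i \<Rightarrow> 'a::euclidean_space \<Rightarrow> ereal"
  assumes J: "finite J" "J \<noteq> {}" and lsc: "\<And>i. i \<in> J \<Longrightarrow> lower_semicont (g i)"
    and f: "f = (\<lambda>x. Min ((\<lambda>i. g i x) ` J))"
  shows "limiting_subdiff f x \<subseteq> (\<Union>i\<in>{i\<in>J. g i x = f x}. limiting_subdiff (g i) x)"
proof
  fix v assume "v \<in> limiting_subdiff f x"
  then obtain xs vs where dom: "f x < \<infinity>" and xs: "xs \<longlonglongrightarrow> x"
    and fxs: "(\<lambda>t. f (xs t)) \<longlonglongrightarrow> f x" and vs: "vs \<longlonglongrightarrow> v"
    and reg: "\<And>t. vs t \<in> regular_subdiff f (xs t)"
    unfolding limiting_subdiff_def effective_dom_def by blast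
  have le: "f z \<le> g i z" if "i \<in> J" for i z
    using J that unfolding f by simp
  have "\<exists>i\<in>J. g i (xs t) = f (xs t)" for t
    using Min_in[of "(\<lambda>i. g i (xs t)) ` J"] J unfolding f by fastforce
  then obtain act where act: "\<And>t. act t \<in> J" "\<And>t. g (act t) (xs t) = f (xs t)"
    by metis
  have "\<exists>t0. infinite {t \<in> UNIV. act t = act t0}"
    using pigeonhole_infinite[of "UNIV :: nat set" act] act(1) J(1)
    by (auto intro: finite_subset)
  then obtain t0 where inf: "infinite {t. act t = act t0}" by auto
  define i where "i = act t0"
  obtain s :: "nat \<Rightarrow> nat" where s: "strict_mono s" "\<And>n. act (s n) = i"
    using infinite_enumerate[OF inf] i_def by auto
  have iJ: "i \<in> J" using act(1) i_def by simp
  have active: "g i (xs (s n)) = f (xs (s n))" for n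
    using act(2)[of "s n"] s(2) by simp
  have xs': "(\<lambda>n. xs (s n)) \<longlonglongrightarrow> x" and vs': "(\<lambda>n. vs (s n)) \<longlonglongrightarrow> v"
    and "(\<lambda>n. f (xs (s n))) \<longlonglongrightarrow> f x"
    using LIMSEQ_subseq_LIMSEQ[OF xs s(1)] LIMSEQ_subseq_LIMSEQ[OF vs s(1)]
      LIMSEQ_subseq_LIMSEQ[OF fxs s(1)] by (simp_all add: o_def)
  then have gxs: "(\<lambda>n. g i (xs (s n))) \<longlonglongrightarrow> f x"
    by (simp add: active)
  then have eq: "g i x = f x"
    using lower_semicont_le_limit[OF lsc[OF iJ] xs'] le[OF iJ] by (simp add: antisym)
  have "vs (s n) \<in> regular_subdiff (g i) (xs (s n))" for n
    using regular_subdiff_mono_touching[of f "g i" "xs (s n)"] le[OF iJ] active reg by auto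
  then have "v \<in> limiting_subdiff (g i) x"
    using xs' vs' gxs dom eq unfolding limiting_subdiff_def effective_dom_def
    by (intro CollectI conjI exI[of _ "\<lambda>n. xs (s n)"] exI[of _ "\<lambda>n. vs (s n)"]) auto
  then show "v \<in> (\<Union>i\<in>{i\<in>J. g i x = f x}. limiting_subdiff (g i) x)"
    using iJ eq by blast
qed

section \<open>The Kurdyka-Lojasiewicz inequality for a finite minimum\<close>

lemma dom_subdiff_finite:
  assumes "proper_fun f" "x \<in> dom_subdiff f"
  shows "\<bar>f x\<bar> \<noteq> \<infinity>"
  using assms unfolding proper_fun_def dom_subdiff_def limiting_subdiff_def effective_dom_def
  by auto

text \<open>Restricting to function gaps below 1 makes the powers decrease in the exponent.\<close>

lemma KL_exponent_mono:
  assumes "KL_exponent f xbar a" "a \<le> b" "b < 1"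
  shows "KL_exponent f xbar b"
proof -
  obtain c \<epsilon> \<nu> where pos: "c > 0" "\<epsilon> > 0" "\<nu> > 0" and kl:
    "\<And>x. norm (x - xbar) \<le> \<epsilon> \<Longrightarrow> f xbar < f x \<Longrightarrow> f x < f xbar + \<nu> \<Longrightarrow>
       ereal (c * (real_of_ereal (f x - f xbar)) powr a) \<le> ext_dist 0 (limiting_subdiff f x)"
    using assms(1) unfolding KL_exponent_def by blast
  have base: "proper_fun f" "lower_semicont f" "xbar \<in> dom_subdiff f" "0 \<le> a"
    using assms(1) unfolding KL_exponent_def by auto
  have fin: "\<bar>f xbar\<bar> \<noteq> \<infinity>"
    using dom_subdiff_finite[of f xbar] base by simp
  have bound: "ereal (c * (real_of_ereal (f x - f xbar)) powr b)
      \<le> ext_dist 0 (limiting_subdiff f x)"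
    if x: "norm (x - xbar) \<le> \<epsilon>" "f xbar < f x" "f x < f xbar + min \<nu> 1" for x
  proof -
    have lt: "f x < f xbar + \<nu>" "f x < f xbar + 1"
      using x(3) by (auto elim!: order_less_le_trans intro!: add_left_mono)
    have "0 \<le> real_of_ereal (f x - f xbar)" "real_of_ereal (f x - f xbar) \<le> 1"
      using x(2) lt(2) fin by (cases "f x"; cases "f xbar"; auto simp: one_ereal_def)+
    then have "(real_of_ereal (f x - f xbar)) powr b \<le> (real_of_ereal (f x - f xbar)) powr a"
      using assms(2) by (intro powr_mono') auto
    then have "ereal (c * (real_of_ereal (f x - f xbar)) powr b)
        \<le> ereal (c * (real_of_ereal (f x - f xbar)) powr a)"
      using pos(1) by simp
    also have "\<dots> \<le> ext_dist 0 (limiting_subdiff f x)"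
      using kl x(1,2) lt(1) by blast
    finally show ?thesis .
  qed
  have "min \<nu> 1 > 0" using pos(3) by simp
  then show ?thesis
    using base pos(1,2) bound assms(2,3) unfolding KL_exponent_def
    by (intro conjI exI[of _ c] exI[of _ \<epsilon>] exI[of _ "min \<nu> 1"]) auto
qed

text \<open>Near xbar the values of h stay above a level m strictly between f xbar and h xbar, and
  \<open>\<nu> = m - f xbar\<close> keeps f below m.  For a minimum f and a member h of its family this says that h
  cannot become active close to xbar while f is only slightly above f xbar.\<close>

lemma inactive_stays_inactive:
  fixes f h :: "'a::real_normed_vector \<Rightarrow> ereal"
  assumes "lower_semicont h" "f xbar < h xbar" "\<bar>f xbar\<bar> \<noteq> \<infinity>"
  obtains \<epsilon> :: real and \<nu> :: ereal where "\<epsilon> > 0" "\<nu> > 0"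
    "\<And>x. norm (x - xbar) \<le> \<epsilon> \<Longrightarrow> f x < f xbar + \<nu> \<Longrightarrow> f x < h x"
proof -
  obtain m where m: "f xbar < m" "m < h xbar"
    using dense[OF assms(2)] by blast
  have "eventually (\<lambda>z. m < h z) (nhds xbar)"
    using lower_semicont_eventually_nhds[OF assms(1) m(2)] .
  then obtain d where d: "d > 0" "\<And>z. dist z xbar < d \<Longrightarrow> m < h z"
    unfolding eventually_nhds_metric by blast
  have "m - f xbar > 0" "f xbar + (m - f xbar) = m"
    using m(1) assms(3) by (cases m; cases "f xbar"; simp)+
  then show ?thesis
    using d by (intro that[of "d / 2" "m - f xbar"]) (auto simp: dist_norm intro: less_trans)
qed

theorem KL_exponent_Min:
  fixes g :: "'i \<Rightarrow> 'a::euclidean_space \<Rightarrow> ereal"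
  assumes J: "finite J" "J \<noteq> {}"
    and pc: "\<And>i. i \<in> J \<Longrightarrow> proper_fun (g i) \<and> lower_semicont (g i)"
    and f: "f = (\<lambda>x. Min ((\<lambda>i. g i x) ` J))"
    and xbar: "xbar \<in> dom_subdiff f"
    and \<beta>: "0 \<le> \<beta>" "\<beta> < 1"
    and KL: "\<And>i. i \<in> J \<Longrightarrow> g i xbar = f xbar \<Longrightarrow> KL_exponent (g i) xbar \<beta>"
  shows "KL_exponent f xbar \<beta>"
proof -
  have proper: "proper_fun f" and lsc: "lower_semicont f"
    unfolding f using proper_fun_Min lower_semicont_Min J pc by blast+
  have fin: "\<bar>f xbar\<bar> \<noteq> \<infinity>"
    using dom_subdiff_finite[OF proper xbar] .
  have le: "f z \<le> g i z" if "i \<in> J" for i z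
    using J that unfolding f by simp
  \<comment> \<open>For an index inactive at xbar the constants make the premises contradictory, so both kinds
     of index are covered by one statement and their constants can be merged together.\<close>
  define good where "good i c \<epsilon> \<nu> \<longleftrightarrow> (c::real) > 0 \<and> (\<epsilon>::real) > 0 \<and> (\<nu>::ereal) > 0 \<and>
     (\<forall>x. norm (x - xbar) \<le> \<epsilon> \<and> f xbar < f x \<and> f x < f xbar + \<nu> \<and> g i x = f x \<longrightarrow>
        ereal (c * (real_of_ereal (f x - f xbar)) powr \<beta>)
          \<le> ext_dist 0 (limiting_subdiff (g i) x))" for i c \<epsilon> \<nu>
  have "\<exists>c \<epsilon> \<nu>. good i c \<epsilon> \<nu>" if i: "i \<in> J" for i
  proof (cases "g i xbar = f xbar")
    case True
    obtain c \<epsilon> \<nu> where "c > 0" "\<epsilon> > 0" "\<nu> > 0" and kl: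
      "\<forall>x. norm (x - xbar) \<le> \<epsilon> \<and> g i xbar < g i x \<and> g i x < g i xbar + \<nu> \<longrightarrow>
         ereal (c * (real_of_ereal (g i x - g i xbar)) powr \<beta>)
           \<le> ext_dist 0 (limiting_subdiff (g i) x)"
      using KL[OF i True] unfolding KL_exponent_def by blast
    then have "good i c \<epsilon> \<nu>"
      unfolding good_def using True by metis
    then show ?thesis by blast
  next
    case False
    then have "f xbar < g i xbar"
      using le[OF i] by (simp add: order_less_le)
    then obtain \<epsilon> \<nu> where "\<epsilon> > 0" "\<nu> > 0"
      "\<And>x. norm (x - xbar) \<le> \<epsilon> \<Longrightarrow> f x < f xbar + \<nu> \<Longrightarrow> f x < g i x"
      using inactive_stays_inactive[of "g i" f xbar] pc[OF i] fin by metis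
    then have "good i 1 \<epsilon> \<nu>"
      unfolding good_def by (metis less_irrefl zero_less_one)
    then show ?thesis by blast
  qed
  then obtain c \<epsilon> \<nu> where good: "\<And>i. i \<in> J \<Longrightarrow> good i (c i) (\<epsilon> i) (\<nu> i)"
    by metis
  define c0 where "c0 = Min (c ` J)"
  define e0 where "e0 = Min (\<epsilon> ` J)"
  define n0 where "n0 = Min (\<nu> ` J)"
  have pos: "c0 > 0" "e0 > 0" "n0 > 0"
    unfolding c0_def e0_def n0_def using J good by (auto simp: good_def)
  have "ereal (c0 * (real_of_ereal (f x - f xbar)) powr \<beta>) \<le> ext_dist 0 (limiting_subdiff f x)"
    if x: "norm (x - xbar) \<le> e0" "f xbar < f x" "f x < f xbar + n0" for x
    unfolding ext_dist_def[of 0 "limiting_subdiff f x"]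
  proof (rule INF_greatest)
    fix v assume "v \<in> limiting_subdiff f x"
    then obtain i where i: "i \<in> J" "g i x = f x" and v: "v \<in> limiting_subdiff (g i) x"
      using limiting_subdiff_Min_subset[OF J _ f] pc by blast
    have min: "c0 \<le> c i" "e0 \<le> \<epsilon> i" "n0 \<le> \<nu> i"
      unfolding c0_def e0_def n0_def using J i by auto
    have "f x < f xbar + \<nu> i"
      using x(3) min(3) by (auto elim!: order_less_le_trans intro!: add_left_mono)
    moreover have "norm (x - xbar) \<le> \<epsilon> i"
      using x(1) min(2) by simp
    ultimately have kl: "ereal (c i * (real_of_ereal (f x - f xbar)) powr \<beta>)
        \<le> ext_dist 0 (limiting_subdiff (g i) x)"
      using good[OF i(1)] x(2) i(2) unfolding good_def by blast
    have "ereal (c0 * (real_of_ereal (f x - f xbar)) powr \<beta>)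
        \<le> ereal (c i * (real_of_ereal (f x - f xbar)) powr \<beta>)"
      using min(1) by (simp add: mult_right_mono)
    also note kl
    also have "ext_dist 0 (limiting_subdiff (g i) x) \<le> ereal (dist 0 v)"
      unfolding ext_dist_def using v by (rule INF_lower)
    finally show "ereal (c0 * (real_of_ereal (f x - f xbar)) powr \<beta>) \<le> ereal (dist 0 v)" .
  qed
  then show ?thesis
    using proper lsc xbar \<beta> pos unfolding KL_exponent_def by blast
qed

theorem theorem3p1:
  fixes r :: nat
    and fs :: "nat \<Rightarrow> real ^ 'n \<Rightarrow> ereal"
    and f :: "real ^ 'n \<Rightarrow> ereal"
    and xbar :: "real ^ 'n"
    and I :: "nat set"
    and \<alpha> :: "nat \<Rightarrow> real"
  assumes "r \<ge> 1"
    and "\<forall>i\<in>{1..r}. proper_fun (fs i) \<and> lower_semicont (fs i)"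
    and "f = (\<lambda>x. Min ((\<lambda>i. fs i x) ` {1..r}))"
    and "continuous_on (dom_subdiff f) f"
    and "I = {i \<in> {1..r}. fs i xbar = f xbar}"
    and "xbar \<in> dom_subdiff f \<inter> (\<Inter>i\<in>I. dom_subdiff (fs i))"
    and "\<forall>i\<in>I. 0 \<le> \<alpha> i \<and> \<alpha> i < 1"
    and "\<forall>i\<in>I. KL_exponent (fs i) xbar (\<alpha> i)"
  shows "KL_exponent f xbar (Max (\<alpha> ` I))"
proof -
  have J: "finite {1..r}" "{1..r} \<noteq> {}"
    using assms(1) by auto
  have "f xbar \<in> (\<lambda>i. fs i xbar) ` {1..r}"
    unfolding assms(3) using J by (intro Min_in) auto
  then have I: "finite I" "I \<noteq> {}"
    unfolding assms(5) by auto
  then have "Max (\<alpha> ` I) \<in> \<alpha> ` I"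
    by (intro Max_in) auto
  then have range: "0 \<le> Max (\<alpha> ` I)" "Max (\<alpha> ` I) < 1"
    using assms(7) by auto
  have "KL_exponent (fs i) xbar (Max (\<alpha> ` I))" if "i \<in> I" for i
    using KL_exponent_mono[of "fs i" xbar "\<alpha> i"] assms(8) that I range(2) by simp
  then show ?thesis
    using KL_exponent_Min[OF J _ assms(3) _ range] assms(2,5,6) by auto
qed

end
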